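(* Let $n\in\mathbb{N}$, $n\ge2$, and let $\Omega\subseteq\mathbb{R}^n$ be open. For every $a\in C^\infty_c(\Omega,\mathbb{R}^n)$ the vector Laplacian decomposes as $$\Delta a=\nabla\operatorname{div}a+M_n(\nabla)^T\operatorname{curl}_n a .$$
   Context: The generalized cross product $\times_n:\mathbb{R}^n\times\mathbb{R}^n\to\mathbb{R}^{n(n-1)/2}$ is the bilinear map for which $a\times_n b$ has entries $\alpha_i\beta_j-\alpha_j\beta_i$ for $1\le i<j\le n$, listed in the order $(i,j)=(1,2),(1,3),(2,3),(1,4),(2,4),(3,4),\ldots$, where $a=(\alpha_i)$ and $b=(\beta_i)$. For $b\in\mathbb{R}^n$, $M_n(b)\in\mathbb{R}^{\frac{n(n-1)}{2}\times n}$ is the unique matrix with $M_n(b)\,x=b\times_n x$ for all $x\in\mathbb{R}^n$; its entries are linear in $b$. Replacing $b$ by the vector differential operator $\nabla=(\partial_1,\ldots,\partial_n)^T$ defines first-order differential operators as follows. For a vector field $a=(a_1,\ldots,a_n)^T$, $\operatorname{curl}_n a=M_n(\nabla)a=\nabla\times_n a$. This is the $\mathbb{R}^{n(n-1)/2}$-valued field with entries $\partial_i a_j-\partial_j a_i$, $i<j$, listed in the order $(i,j)=(1,2),(1,3),(2,3),(1,4),(2,4),(3,4),\ldots$. For a field $\mathfrak{a}=(\mathfrak{a}_{ij})_{i<j}$ with values in $\mathbb{R}^{n(n-1)/2}$ (indexed in the order $(i,j)=(1,2),(1,3),(2,3),(1,4),(2,4),(3,4),\ldots$), $M_n(\nabla)^T\mathfrak{a}$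 is the $\mathbb{R}^n$-valued field with $k$-th component $\sum_{i<k}\partial_i\mathfrak{a}_{ik}-\sum_{j>k}\partial_j\mathfrak{a}_{kj}$. The Laplacian $\Delta$ acts componentwise on vector fields, and $\operatorname{div}a=\sum_i\partial_i a_i$. *)

theory Defs
  imports "HOL-Analysis.Analysis"
begin

section \<open>The coordinates of the generalized cross product\<close>

text \<open>
  The coordinates of \<open>\<real>\<^sup>n\<close> are indexed by a finite linearly ordered type \<open>'n\<close> with \<open>CARD('n) = n\<close>,
  those of \<open>\<real>\<^bsup>n(n-1)/2\<^esup>\<close> by a finite linearly ordered type \<open>'m\<close> with \<open>CARD('m) = n(n-1)/2\<close>.
  The pairs \<open>i < j\<close> are listed as \<open>(1,2), (1,3), (2,3), (1,4), (2,4), (3,4), \<dots>\<close>, i.e. ordered by \<open>j\<close>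
  first and by \<open>i\<close> second; \<open>pair_of p\<close> is the pair in position \<open>p\<close> of this list.
\<close>

definition index_pairs :: "('n::{finite,linorder} \<times> 'n) set" where
  "index_pairs = {(i, j). i < j}"

definition colex_less :: "'n::{finite,linorder} \<times> 'n \<Rightarrow> 'n \<times> 'n \<Rightarrow> bool" where
  "colex_less q r \<longleftrightarrow> snd q < snd r \<or> snd q = snd r \<and> fst q < fst r"

definition pair_of :: "'m::{finite,linorder} \<Rightarrow> 'n::{finite,linorder} \<times> 'n" where
  "pair_of p = (THE q. q \<in> index_pairs \<and>
     card {r \<in> index_pairs. colex_less r q} = card {p'. p' < p})"

definition gcross :: "real^'n::{finite,linorder} \<Rightarrow> real^'n::{finite,linorder} \<Rightarrow> real^'m::{finite,linorder}" where
  "gcross a b = (\<chi> p. case pair_of p of (i, j) \<Rightarrow> a $ i * b $ j - a $ j * b $ i)"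

definition M :: "real^'n::{finite,linorder} \<Rightarrow> real^'n::{finite,linorder}^'m::{finite,linorder}" where
  "M b = (THE A. \<forall>x. A *v x = gcross b x)"


section \<open>Differential operators\<close>

definition partial :: "'n \<Rightarrow> (real^'n \<Rightarrow> 'b::real_normed_vector) \<Rightarrow> real^'n \<Rightarrow> 'b" where
  "partial i f x = vector_derivative (\<lambda>t. f (x + t *\<^sub>R axis i 1)) (at 0)"

definition grad :: "(real^'n \<Rightarrow> real) \<Rightarrow> real^'n \<Rightarrow> real^'n" where
  "grad f x = (\<chi> i. partial i f x)"

definition divergence :: "(real^'n \<Rightarrow> real^'n) \<Rightarrow> real^'n \<Rightarrow> real" where
  "divergence a x = (\<Sum>i\<in>UNIV. partial i (\<lambda>y. a y $ i) x)"

definition laplacian :: "(real^'n \<Rightarrow> real) \<Rightarrow> real^'n \<Rightarrow> real" where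
  "laplacian f x = (\<Sum>i\<in>UNIV. partial i (partial i f) x)"

definition vector_laplacian :: "(real^'n \<Rightarrow> real^'k) \<Rightarrow> real^'n \<Rightarrow> real^'k" where
  "vector_laplacian a x = (\<chi> k. laplacian (\<lambda>y. a y $ k) x)"

text \<open>
  For a matrix \<open>A b\<close> whose entries are linear in \<open>b\<close>, replacing \<open>b\<close> by \<open>\<nabla>\<close> turns the entry
  \<open>A b $ p $ q = (\<Sum>i\<in>UNIV. b $ i * A (axis i 1) $ p $ q)\<close> into the first-order operator
  \<open>\<Sum>i\<in>UNIV. A (axis i 1) $ p $ q * \<partial>\<^sub>i\<close>.
\<close>

definition nabla_op :: "(real^'n \<Rightarrow> real^'q^'p) \<Rightarrow> (real^'n \<Rightarrow> real^'q) \<Rightarrow> real^'n \<Rightarrow> real^'p" where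
  "nabla_op A u x =
     (\<chi> p. \<Sum>q\<in>UNIV. \<Sum>i\<in>UNIV. A (axis i 1) $ p $ q * partial i (\<lambda>y. u y $ q) x)"

definition curl ::
    "(real^'n::{finite,linorder} \<Rightarrow> real^'n::{finite,linorder}) \<Rightarrow> real^'n::{finite,linorder} \<Rightarrow> real^'m::{finite,linorder}" where
  "curl = nabla_op M"

definition M_nabla_transpose ::
    "(real^'n::{finite,linorder} \<Rightarrow> real^'m::{finite,linorder}) \<Rightarrow> real^'n::{finite,linorder} \<Rightarrow> real^'n::{finite,linorder}" where
  "M_nabla_transpose = nabla_op (\<lambda>b. transpose (M b))"


section \<open>Smooth functions with compact support\<close>

primrec Ck_on :: "nat \<Rightarrow> (real^'n) set \<Rightarrow> (real^'n \<Rightarrow> 'b::real_normed_vector) \<Rightarrow> bool" where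
  "Ck_on 0 S f \<longleftrightarrow> continuous_on S f"
| "Ck_on (Suc k) S f \<longleftrightarrow> (\<forall>x\<in>S. f differentiable (at x)) \<and> (\<forall>i. Ck_on k S (partial i f))"

text \<open>
  Only the values on \<open>S\<close> matter: a field on \<open>S\<close> is represented by any total function extending it.
\<close>

definition Cinf_compact :: "(real^'n) set \<Rightarrow> (real^'n \<Rightarrow> 'b::real_normed_vector) set" where
  "Cinf_compact S = {f. (\<forall>k. Ck_on k S f) \<and>
     compact (closure {x \<in> S. f x \<noteq> 0}) \<and> closure {x \<in> S. f x \<noteq> 0} \<subseteq> S}"


section \<open>Agreement with the componentwise formulas\<close>

lemma bij_betw_pair_of:
  assumes "CARD('m::{finite,linorder}) = CARD('n::{finite,linorder}) * (CARD('n) - 1) div 2"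
  shows "bij_betw (pair_of :: 'm \<Rightarrow> 'n \<times> 'n) UNIV index_pairs"
proof -
  have rank: "bij_betw (\<lambda>x. card {y \<in> A. R y x}) A {..<card A}"
    if "finite A" and tr: "\<And>x y z. R x y \<Longrightarrow> R y z \<Longrightarrow> R x z" and irr: "\<And>x. \<not> R x x"
      and tot: "\<And>x y. x \<noteq> y \<Longrightarrow> R x y \<or> R y x"
    for A :: "'z set" and R
  proof -
    have mono: "card {y \<in> A. R y x} < card {y \<in> A. R y x'}" if "x \<in> A" "R x x'" for x x'
    proof (rule psubset_card_mono)
      have "x \<in> {y \<in> A. R y x'}" "x \<notin> {y \<in> A. R y x}" using that irr by auto
      then show "{y \<in> A. R y x} \<subset> {y \<in> A. R y x'}" using that tr by blast
    qed (use \<open>finite A\<close> in simp)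
    have inj: "inj_on (\<lambda>x. card {y \<in> A. R y x}) A"
    proof (rule inj_onI, rule ccontr)
      fix x x'
      assume *: "x \<in> A" "x' \<in> A" "card {y \<in> A. R y x} = card {y \<in> A. R y x'}" "x \<noteq> x'"
      from tot[OF *(4)] show False using mono[of x x'] mono[of x' x] *(1-3) by auto
    qed
    have sub: "(\<lambda>x. card {y \<in> A. R y x}) ` A \<subseteq> {..<card A}"
      using \<open>finite A\<close> irr by (auto intro!: psubset_card_mono)
    show ?thesis
      using inj sub by (simp add: bij_betw_def card_image card_subset_eq)
  qed
  have P: "bij_betw (\<lambda>q. card {r \<in> index_pairs. colex_less r q})
      (index_pairs :: ('n \<times> 'n) set) {..<card (index_pairs :: ('n \<times> 'n) set)}"
  proof (rule rank)
    show "colex_less x y \<or> colex_less y x" if "x \<noteq> y" for x y :: "'n \<times> 'n"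
      using that by (auto simp: colex_less_def prod_eq_iff neq_iff)
    show "colex_less x z" if "colex_less x y" "colex_less y z" for x y z :: "'n \<times> 'n"
      using that unfolding colex_less_def by (metis less_trans)
  qed (simp_all add: colex_less_def)
  have Q: "bij_betw (\<lambda>p::'m. card {p'. p' < p}) UNIV {..<CARD('m)}"
  proof -
    have "bij_betw (\<lambda>p::'m. card {p' \<in> UNIV. p' < p}) UNIV {..<CARD('m)}"
    proof (rule rank)
      show "x < y \<or> y < x" if "x \<noteq> y" for x y :: 'm
        using that by (simp add: neq_iff)
    qed (simp_all add: less_trans)
    then show ?thesis by simp
  qed
  have c: "card (index_pairs :: ('n \<times> 'n) set) = CARD('m)"
  proof -
    let ?I = "index_pairs :: ('n \<times> 'n) set" and ?D = "range (\<lambda>i::'n. (i, i))"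
    have U: "(UNIV :: ('n \<times> 'n) set) = (?I \<union> prod.swap ` ?I) \<union> ?D"
      by (auto simp: index_pairs_def image_iff)
    have "CARD('n \<times> 'n) = card (?I \<union> prod.swap ` ?I) + card ?D"
      unfolding U by (rule card_Un_disjoint) (auto simp: index_pairs_def)
    also have "card (?I \<union> prod.swap ` ?I) = card ?I + card (prod.swap ` ?I)"
      by (rule card_Un_disjoint) (auto simp: index_pairs_def)
    also have "card (prod.swap ` ?I) = card ?I" by (simp add: card_image)
    also have "card ?D = CARD('n)" by (simp add: card_image inj_on_def)
    finally have "CARD('n) * CARD('n) = 2 * card ?I + CARD('n)" by simp
    then have "CARD('n) * (CARD('n) - 1) = 2 * card ?I" by (simp add: diff_mult_distrib2)
    then show ?thesis using assms by simp
  qed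
  let ?f = "\<lambda>q :: 'n \<times> 'n. card {r \<in> index_pairs. colex_less r q}"
  have "pair_of = (\<lambda>p::'m. the_inv_into index_pairs ?f (card {p'. p' < p}))"
    by (simp add: fun_eq_iff pair_of_def the_inv_into_def)
  moreover have inv: "bij_betw (the_inv_into index_pairs ?f) {..<CARD('m)} index_pairs"
    using bij_betw_the_inv_into[OF P] c by simp
  ultimately show ?thesis
    using bij_betw_trans[OF Q inv] by (simp only: comp_def)
qed

lemma M_mult: "M b *v x = (gcross b x :: real^'m::{finite,linorder})"
  for b :: "real^'n::{finite,linorder}"
proof -
  have lin: "linear (gcross b :: real^'n::{finite,linorder} \<Rightarrow> real^'m::{finite,linorder})"
    by (rule linearI) (auto simp: gcross_def vec_eq_iff algebra_simps split: prod.split)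
  have mf: "\<forall>x. matrix (gcross b :: real^'n::{finite,linorder} \<Rightarrow> real^'m::{finite,linorder}) *v x = gcross b x"
    using matrix_vector_mul(2)[OF lin] by (simp add: fun_eq_iff)
  then have "\<exists>!A :: real^'n::{finite,linorder}^'m::{finite,linorder}. \<forall>x. A *v x = gcross b x"
    by (rule ex1I) (simp add: matrix_eq mf)
  from theI'[OF this] show ?thesis by (simp add: M_def)
qed

lemma M_nth:
  fixes b :: "real^'n::{finite,linorder}" and p :: "'m::{finite,linorder}"
  shows "M b $ p $ q = (case pair_of p of (i, j) \<Rightarrow>
    b $ i * (if q = j then 1 else 0) - b $ j * (if q = i then 1 else 0))"
proof -
  have "M b $ p $ q = (M b *v axis q 1) $ p"
    by (simp add: matrix_vector_mul_component inner_axis)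
  then show ?thesis
    unfolding M_mult by (auto simp: gcross_def axis_def split: prod.split)
qed

lemma sum_M_axis:
  fixes p :: "'m::{finite,linorder}" and q :: "'n::{finite,linorder}"
  shows "(\<Sum>i\<in>UNIV. M (axis i 1) $ p $ q * c i) = (case pair_of p of (i, j) \<Rightarrow>
    (if q = j then c i else 0) - (if q = i then c j else 0))"
proof -
  obtain i j :: 'n where p: "pair_of p = (i, j)" by (cases "pair_of p :: 'n \<times> 'n")
  have eq: "M (axis l 1) $ p $ q * c l = (if l = i then if q = j then c i else 0 else 0)
      - (if l = j then if q = i then c j else 0 else 0)" for l
    by (simp add: M_nth p axis_def)
  show ?thesis unfolding eq by (simp add: p sum_subtractf)
qed

lemma curl_nth:
  fixes p :: "'m::{finite,linorder}"
    and a :: "real^'n::{finite,linorder} \<Rightarrow> real^'n::{finite,linorder}"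
  shows "curl a x $ p = (case pair_of p of (i, j) \<Rightarrow>
    partial i (\<lambda>y. a y $ j) x - partial j (\<lambda>y. a y $ i) x)"
  by (simp add: curl_def nabla_op_def sum_M_axis case_prod_beta sum_subtractf)

lemma M_nabla_transpose_nth:
  fixes u :: "real^'n::{finite,linorder} \<Rightarrow> real^'m::{finite,linorder}"
  assumes "CARD('m) = CARD('n) * (CARD('n) - 1) div 2"
  shows "M_nabla_transpose u x $ k =
    (\<Sum>i | i < k. partial i (\<lambda>y. u y $ the_inv pair_of (i, k)) x)
    - (\<Sum>j | k < j. partial j (\<lambda>y. u y $ the_inv pair_of (k, j)) x)"
proof -
  note bij = bij_betw_pair_of[OF assms]
  define D where "D = (\<lambda>(i, j) l. partial l (\<lambda>y. u y $ the_inv (pair_of :: 'm \<Rightarrow> 'n \<times> 'n) (i, j)) x)"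
  have inv: "the_inv (pair_of :: 'm \<Rightarrow> 'n \<times> 'n) (pair_of p) = p" for p
    using bij by (simp add: bij_betw_def the_inv_f_f)
  have "M_nabla_transpose u x $ k = (\<Sum>p\<in>(UNIV::'m set). \<Sum>i\<in>UNIV. M (axis i 1) $ p $ k * D (pair_of p) i)"
    by (simp add: M_nabla_transpose_def nabla_op_def transpose_def D_def case_prod_beta inv)
  also have "\<dots> = (\<Sum>p\<in>(UNIV::'m set). (\<lambda>(i, j). (if j = k then D (i, j) i else 0)
      - (if i = k then D (i, j) j else 0)) (pair_of p))"
    by (rule sum.cong) (auto simp: sum_M_axis split: prod.split)
  also have "\<dots> = (\<Sum>(i, j)\<in>index_pairs. (if j = k then D (i, j) i else 0)
      - (if i = k then D (i, j) j else 0))"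
    by (rule sum.reindex_bij_betw[OF bij])
  also have "\<dots> = (\<Sum>q\<in>index_pairs. if snd q = k then D q (fst q) else 0)
      - (\<Sum>q\<in>index_pairs. if fst q = k then D q (snd q) else 0)"
    unfolding sum_subtractf[symmetric] by (rule sum.cong) auto
  also have "(\<Sum>q\<in>index_pairs. if snd q = k then D q (fst q) else 0)
      = (\<Sum>q\<in>(\<lambda>i. (i, k)) ` {i. i < k}. D q (fst q))"
    by (rule sum.mono_neutral_cong_right) (auto simp: index_pairs_def)
  also have "(\<Sum>q\<in>index_pairs. if fst q = k then D q (snd q) else 0)
      = (\<Sum>q\<in>(\<lambda>j. (k, j)) ` {j. k < j}. D q (snd q))"
    by (rule sum.mono_neutral_cong_right) (auto simp: index_pairs_def)
  finally show ?thesis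
    by (simp add: sum.reindex inj_on_def D_def)
qed

end

theory Submission
  imports Defs
begin

text \<open>
  Write \<open>a\<^sub>k\<close> for the components of \<open>a\<close>. Both sides of the identity are sums of second partial
  derivatives: the \<open>k\<close>-th component of \<open>M\<^sub>n(\<nabla>)\<^sup>T curl a\<close> is
  \<open>\<Sum>i<k. \<partial>\<^sub>i (\<partial>\<^sub>i a\<^sub>k - \<partial>\<^sub>k a\<^sub>i) - \<Sum>j>k. \<partial>\<^sub>j (\<partial>\<^sub>k a\<^sub>j - \<partial>\<^sub>j a\<^sub>k)\<close>, and since reversing a pair changes
  the sign of its curl entry, both sums have the same summand and combine to
  \<open>\<Sum>i\<noteq>k. \<partial>\<^sub>i \<partial>\<^sub>i a\<^sub>k - \<partial>\<^sub>i \<partial>\<^sub>k a\<^sub>i\<close>; the excluded term \<open>i = k\<close> would be zero. The subtracted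
  part is \<open>\<partial>\<^sub>k div a\<close> as soon as \<open>\<partial>\<^sub>i \<partial>\<^sub>k a\<^sub>i = \<partial>\<^sub>k \<partial>\<^sub>i a\<^sub>i\<close>.

  So the only analytic content is the symmetry of second partial derivatives,
  \<open>partial_commute\<close>. It is derived from the mean value theorem: the second
  difference of \<open>f\<close> at \<open>x\<close> with step \<open>h\<close> is \<open>h\<^sup>2\<close> times a value of \<open>\<partial>\<^sub>j \<partial>\<^sub>i f\<close> near \<open>x\<close>
  (\<open>second_difference_eq_partial\<close>) and, being symmetric in the two directions, also \<open>h\<^sup>2\<close> times
  a value of \<open>\<partial>\<^sub>i \<partial>\<^sub>j f\<close> near \<open>x\<close>; continuity as \<open>h \<rightarrow> 0\<close> identifies the two at \<open>x\<close>.
\<close>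

section \<open>Calculus of partial derivatives\<close>

lemma has_vector_derivative_partial_line:
  fixes f :: "real^'n \<Rightarrow> 'b::real_normed_vector"
  assumes "f differentiable (at (x + s *\<^sub>R axis i 1))"
  shows "((\<lambda>t. f (x + t *\<^sub>R axis i 1)) has_vector_derivative partial i f (x + s *\<^sub>R axis i 1)) (at s)"
proof -
  let ?y = "x + s *\<^sub>R axis i 1"
  from assms obtain f' where f': "(f has_derivative f') (at ?y)"
    by (auto simp: differentiable_def)
  have *: "((\<lambda>t. f (z + t *\<^sub>R axis i 1)) has_vector_derivative f' (axis i 1)) (at r)"
    if "z + r *\<^sub>R axis i 1 = ?y" for z r
  proof -
    have "((\<lambda>t. z + t *\<^sub>R axis i 1) has_derivative (\<lambda>t. t *\<^sub>R axis i 1)) (at r)"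
      by (auto intro!: derivative_eq_intros)
    moreover have "(f has_derivative f') (at (z + r *\<^sub>R axis i 1))"
      using f' that by simp
    ultimately have "((\<lambda>t. f (z + t *\<^sub>R axis i 1)) has_derivative (\<lambda>t. f' (t *\<^sub>R axis i 1))) (at r)"
      by (rule has_derivative_compose)
    then show ?thesis
      using linear_scale[OF has_derivative_linear[OF f']] by (simp add: has_vector_derivative_def)
  qed
  have "partial i f ?y = f' (axis i 1)"
    unfolding partial_def by (rule vector_derivative_at) (rule *, simp)
  with *[of x s] show ?thesis by simp
qed

lemma has_vector_derivative_partial:
  fixes f :: "real^'n \<Rightarrow> 'b::real_normed_vector"
  assumes "f differentiable (at x)"
  shows "((\<lambda>t. f (x + t *\<^sub>R axis i 1)) has_vector_derivative partial i f x) (at 0)"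
  using has_vector_derivative_partial_line[of f x 0 i] assms by simp

lemma partial_diff:
  fixes f g :: "real^'n \<Rightarrow> 'b::real_normed_vector"
  assumes "f differentiable (at x)" "g differentiable (at x)"
  shows "partial i (\<lambda>y. f y - g y) x = partial i f x - partial i g x"
  unfolding partial_def[of i "\<lambda>y. f y - g y"]
  by (intro vector_derivative_at has_vector_derivative_diff has_vector_derivative_partial assms)

lemma partial_sum:
  fixes f :: "'c \<Rightarrow> real^'n \<Rightarrow> 'b::real_normed_vector"
  assumes "\<And>l. l \<in> L \<Longrightarrow> f l differentiable (at x)"
  shows "partial i (\<lambda>y. \<Sum>l\<in>L. f l y) x = (\<Sum>l\<in>L. partial i (f l) x)"
  unfolding partial_def[of i "\<lambda>y. \<Sum>l\<in>L. f l y"]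
  by (intro vector_derivative_at has_vector_derivative_sum has_vector_derivative_partial assms)

lemma partial_vec_nth:
  fixes f :: "real^'n \<Rightarrow> real^'k"
  assumes "f differentiable (at x)"
  shows "partial i (\<lambda>y. f y $ k) x = partial i f x $ k"
  unfolding partial_def[of i "\<lambda>y. f y $ k"]
  by (intro vector_derivative_at bounded_linear.has_vector_derivative[OF bounded_linear_vec_nth]
        has_vector_derivative_partial assms)

lemma partial_cong_open:
  fixes f g :: "real^'n \<Rightarrow> 'b::real_normed_vector"
  assumes "open S" "x \<in> S" and eq: "\<And>y. y \<in> S \<Longrightarrow> f y = g y"
  shows "partial i f x = partial i g x"
proof -
  have "\<forall>\<^sub>F t in nhds 0. x + t *\<^sub>R axis i 1 \<in> S"
  proof (rule topological_tendstoD)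
    show "((\<lambda>t. x + t *\<^sub>R axis i 1) \<longlongrightarrow> x) (nhds (0::real))"
      by (rule tendsto_eq_intros filterlim_ident refl | simp)+
  qed (use assms in auto)
  then have "\<forall>\<^sub>F t in nhds 0. t \<in> UNIV \<longrightarrow> f (x + t *\<^sub>R axis i 1) = g (x + t *\<^sub>R axis i 1)"
    by eventually_elim (use eq in auto)
  then show ?thesis
    unfolding partial_def by (intro vector_derivative_cong_eq) auto
qed

lemma Ck_on_cong_open:
  fixes f g :: "real^'n \<Rightarrow> 'b::real_normed_vector"
  assumes "open S" and eq: "\<And>y. y \<in> S \<Longrightarrow> f y = g y" and "Ck_on k S f"
  shows "Ck_on k S g"
  using eq \<open>Ck_on k S f\<close>
proof (induction k arbitrary: f g)
  case 0
  then show ?case using continuous_on_cong[of S S f g] by simp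
next
  case (Suc k)
  have "g differentiable (at x)" if "x \<in> S" for x
  proof -
    from Suc.prems(2) that obtain f' where "(f has_derivative f') (at x)"
      by (auto simp: differentiable_def)
    then have "(g has_derivative f') (at x)"
      by (rule has_derivative_transform_within_open[OF _ \<open>open S\<close> that]) (rule Suc.prems(1))
    then show ?thesis by (auto simp: differentiable_def)
  qed
  moreover have "Ck_on k S (partial i g)" for i
    using Suc.IH[of "partial i f" "partial i g"] Suc.prems partial_cong_open[OF \<open>open S\<close>, of _ f g] by auto
  ultimately show ?case by simp
qed

text \<open>
  Off \<open>S\<close> the map \<open>f\<close> need not be differentiable, so that \<open>\<partial>\<^sub>i\<close> commutes with taking components only
  on \<open>S\<close>; \<open>Ck_on_cong_open\<close> carries this partial agreement through the recursion.
\<close>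

lemma Ck_on_vec_nth:
  fixes f :: "real^'n \<Rightarrow> real^'k"
  assumes "open S" "Ck_on m S f"
  shows "Ck_on m S (\<lambda>y. f y $ k)"
  using assms(2)
proof (induction m arbitrary: f)
  case 0
  then show ?case by (auto intro!: continuous_intros)
next
  case (Suc m)
  have "(\<lambda>y. f y $ k) differentiable (at x)" if "x \<in> S" for x
    using Suc.prems that bounded_linear.has_derivative[OF bounded_linear_vec_nth]
    by (fastforce simp: differentiable_def)
  moreover have "Ck_on m S (partial i (\<lambda>y. f y $ k))" for i
  proof (rule Ck_on_cong_open[OF \<open>open S\<close>])
    show "Ck_on m S (\<lambda>y. partial i f y $ k)"
      using Suc.IH[of "partial i f"] Suc.prems by simp
    show "partial i f y $ k = partial i (\<lambda>y. f y $ k) y" if "y \<in> S" for y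
      using partial_vec_nth[of f y i k] Suc.prems that by simp
  qed
  ultimately show ?case by simp
qed


section \<open>Symmetry of second partial derivatives\<close>

text \<open>
  Apply the mean value theorem first to \<open>f (\<sqdot> + h e\<^sub>j) - f\<close> along \<open>e\<^sub>i\<close>, then to \<open>\<partial>\<^sub>i f\<close> along \<open>e\<^sub>j\<close>.
\<close>

lemma second_difference_eq_partial:
  fixes f :: "real^'n \<Rightarrow> real"
  assumes h: "h > 0" and sub: "cball x (2 * h) \<subseteq> S"
    and f: "\<And>y. y \<in> S \<Longrightarrow> f differentiable (at y)"
    and pf: "\<And>y. y \<in> S \<Longrightarrow> partial i f differentiable (at y)"
  obtains y where "dist y x \<le> 2 * h"
    "f (x + h *\<^sub>R axis i 1 + h *\<^sub>R axis j 1) - f (x + h *\<^sub>R axis i 1) - f (x + h *\<^sub>R axis j 1) + f x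
      = h * h * partial j (partial i f) y"
proof -
  let ?u = "axis i 1 :: real^'n" and ?v = "axis j 1 :: real^'n"
  have near: "dist (x + s *\<^sub>R ?u + t *\<^sub>R ?v) x \<le> 2 * h" if "0 \<le> s" "s \<le> h" "0 \<le> t" "t \<le> h" for s t
  proof -
    have "norm (s *\<^sub>R ?u + t *\<^sub>R ?v) \<le> norm (s *\<^sub>R ?u) + norm (t *\<^sub>R ?v)"
      by (rule norm_triangle_ineq)
    also have "\<dots> \<le> 2 * h" using that by simp
    finally show ?thesis by (simp add: dist_norm add.assoc)
  qed
  then have inS: "x + s *\<^sub>R ?u + t *\<^sub>R ?v \<in> S" if "0 \<le> s" "s \<le> h" "0 \<le> t" "t \<le> h" for s t
    using sub that by (auto simp: dist_commute)
  define \<phi> where "\<phi> s = f ((x + h *\<^sub>R ?v) + s *\<^sub>R ?u) - f (x + s *\<^sub>R ?u)" for s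
  have "(\<phi> has_real_derivative
      partial i f ((x + h *\<^sub>R ?v) + s *\<^sub>R ?u) - partial i f (x + s *\<^sub>R ?u)) (at s)"
    if "0 \<le> s" "s \<le> h" for s
    unfolding \<phi>_def has_real_derivative_iff_has_vector_derivative
    using inS[OF that, of h] inS[OF that, of 0] h
    by (intro has_vector_derivative_diff has_vector_derivative_partial_line f)
       (simp_all add: algebra_simps)
  from MVT2[OF h this] obtain s where s: "0 < s" "s < h"
    and 1: "\<phi> h - \<phi> 0 = h * (partial i f ((x + h *\<^sub>R ?v) + s *\<^sub>R ?u) - partial i f (x + s *\<^sub>R ?u))"
    by auto
  have "((\<lambda>t. partial i f ((x + s *\<^sub>R ?u) + t *\<^sub>R ?v)) has_real_derivative
      partial j (partial i f) ((x + s *\<^sub>R ?u) + t *\<^sub>R ?v)) (at t)"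
    if "0 \<le> t" "t \<le> h" for t
    unfolding has_real_derivative_iff_has_vector_derivative
    using inS[of s t] that s by (intro has_vector_derivative_partial_line pf) simp
  from MVT2[OF h this] obtain t where t: "0 < t" "t < h"
    and 2: "partial i f ((x + s *\<^sub>R ?u) + h *\<^sub>R ?v) - partial i f ((x + s *\<^sub>R ?u) + 0 *\<^sub>R ?v)
      = h * partial j (partial i f) ((x + s *\<^sub>R ?u) + t *\<^sub>R ?v)"
    by auto
  show thesis
  proof
    show "dist (x + s *\<^sub>R ?u + t *\<^sub>R ?v) x \<le> 2 * h" using near s t by simp
    show "f (x + h *\<^sub>R ?u + h *\<^sub>R ?v) - f (x + h *\<^sub>R ?u) - f (x + h *\<^sub>R ?v) + f x
        = h * h * partial j (partial i f) (x + s *\<^sub>R ?u + t *\<^sub>R ?v)"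
      using 1 2 by (simp add: \<phi>_def add_ac)
  qed
qed

lemma partial_commute:
  fixes f :: "real^'n \<Rightarrow> real"
  assumes "open S" "x \<in> S" and C2: "Ck_on 2 S f"
  shows "partial i (partial j f) x = partial j (partial i f) x"
proof -
  have f: "f differentiable (at y)" if "y \<in> S" for y
    using C2 that by (simp add: numeral_2_eq_2)
  have pf: "partial l f differentiable (at y)" if "y \<in> S" for y l
    using C2 that by (simp add: numeral_2_eq_2)
  have cont: "isCont (partial l (partial k f)) x" for k l
  proof -
    have "continuous_on S (partial l (partial k f))" using C2 by (simp add: numeral_2_eq_2)
    then show ?thesis using continuous_on_eq_continuous_at[OF \<open>open S\<close>] \<open>x \<in> S\<close> by blast
  qed
  let ?A = "partial i (partial j f)" and ?B = "partial j (partial i f)"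
  have "dist (?A x) (?B x) \<le> 0 + e" if "e > 0" for e
  proof -
    from cont[of i j] obtain d1 where d1: "d1 > 0" "\<And>y. dist y x < d1 \<Longrightarrow> dist (?A y) (?A x) < e / 2"
      using \<open>e > 0\<close> unfolding continuous_at_eps_delta by (meson half_gt_zero)
    from cont[of j i] obtain d2 where d2: "d2 > 0" "\<And>y. dist y x < d2 \<Longrightarrow> dist (?B y) (?B x) < e / 2"
      using \<open>e > 0\<close> unfolding continuous_at_eps_delta by (meson half_gt_zero)
    from \<open>open S\<close> \<open>x \<in> S\<close> obtain d3 where d3: "d3 > 0" "cball x d3 \<subseteq> S"
      by (auto simp: open_contains_cball)
    \<comment> \<open>The intermediate points found below lie within distance \<open>2 * h\<close> of \<open>x\<close>, so \<open>2 * h\<close>, not \<open>h\<close>, has to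
      stay below all three radii.\<close>
    define h where "h = min (min d1 d2) d3 / 3"
    have h: "h > 0" "2 * h < d1" "2 * h < d2" "2 * h \<le> d3"
      using d1(1) d2(1) d3(1) by (auto simp: h_def min_def)
    then have sub: "cball x (2 * h) \<subseteq> S" using d3(2) by (meson order_trans subset_cball)
    obtain y where y: "dist y x \<le> 2 * h"
      "f (x + h *\<^sub>R axis i 1 + h *\<^sub>R axis j 1) - f (x + h *\<^sub>R axis i 1) - f (x + h *\<^sub>R axis j 1) + f x
        = h * h * ?B y"
      using second_difference_eq_partial[OF h(1) sub f pf] by blast
    obtain z where z: "dist z x \<le> 2 * h"
      "f (x + h *\<^sub>R axis j 1 + h *\<^sub>R axis i 1) - f (x + h *\<^sub>R axis j 1) - f (x + h *\<^sub>R axis i 1) + f x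
        = h * h * ?A z"
      using second_difference_eq_partial[OF h(1) sub f pf] by blast
    have "h * h * ?A z = h * h * ?B y"
      unfolding y(2)[symmetric] z(2)[symmetric] by (simp add: add_ac)
    then have "?A z = ?B y" using h(1) by simp
    moreover have "dist (?A z) (?A x) < e / 2" "dist (?B y) (?B x) < e / 2"
      using d1(2)[of z] d2(2)[of y] y(1) z(1) h by auto
    ultimately show ?thesis unfolding dist_real_def by linarith
  qed
  then have "dist (?A x) (?B x) \<le> 0" by (rule field_le_epsilon)
  then show ?thesis by simp
qed


section \<open>The decomposition of the vector Laplacian\<close>

lemma curl_nth_the_inv:
  fixes a :: "real^'n::{finite,linorder} \<Rightarrow> real^'n::{finite,linorder}"
  assumes "CARD('m::{finite,linorder}) = CARD('n) * (CARD('n) - 1) div 2" and "i < j"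
  shows "(curl a y :: real^'m::{finite,linorder}) $ the_inv pair_of (i, j)
    = partial i (\<lambda>y. a y $ j) y - partial j (\<lambda>y. a y $ i) y"
proof -
  have "pair_of (the_inv (pair_of :: 'm \<Rightarrow> 'n \<times> 'n) (i, j)) = (i, j)"
    using bij_betw_pair_of[OF assms(1)] \<open>i < j\<close>
    by (intro f_the_inv_into_f_bij_betw) (auto simp: index_pairs_def)
  then show ?thesis by (simp add: curl_nth)
qed

theorem mainTheorem4:
  fixes \<Omega> :: "(real^'n::{finite,linorder}) set"
    and a :: "real^'n::{finite,linorder} \<Rightarrow> real^'n::{finite,linorder}"
  assumes "CARD('n) \<ge> 2"
    and "CARD('m::{finite,linorder}) = CARD('n) * (CARD('n) - 1) div 2"
    and "open \<Omega>"
    and "a \<in> Cinf_compact \<Omega>"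
  shows "\<forall>x\<in>\<Omega>. vector_laplacian a x =
    grad (divergence a) x + M_nabla_transpose (curl a :: real^'n::{finite,linorder} \<Rightarrow> real^'m::{finite,linorder}) x"
proof
  fix x assume x: "x \<in> \<Omega>"
  define b where "b k y = a y $ k" for k y
  define D where "D i j k = partial i (partial j (b k)) x" for i j k
  have C2: "Ck_on 2 \<Omega> (b k)" for k
    using \<open>a \<in> Cinf_compact \<Omega>\<close> Ck_on_vec_nth[OF \<open>open \<Omega>\<close>, of 2 a k]
    by (simp add: Cinf_compact_def b_def[abs_def])
  have diff: "partial j (b k) differentiable (at x)" for j k
    using C2[of k] x by (simp add: numeral_2_eq_2)
  have curl: "(curl a y :: real^'m::{finite,linorder}) $ the_inv pair_of (i, j) = partial i (b j) y - partial j (b i) y"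
    if "i < j" for i j y
    using curl_nth_the_inv[OF assms(2) that] by (simp add: b_def[abs_def])
  show "vector_laplacian a x = grad (divergence a) x + M_nabla_transpose (curl a :: real^'n::{finite,linorder} \<Rightarrow> real^'m::{finite,linorder}) x"
  proof (rule vec_eq_iff[THEN iffD2], rule allI)
    fix k
    have lap: "vector_laplacian a x $ k = (\<Sum>i\<in>UNIV. D i i k)"
      by (simp add: vector_laplacian_def laplacian_def D_def b_def[abs_def])
    have "grad (divergence a) x $ k = partial k (\<lambda>y. \<Sum>i\<in>UNIV. partial i (b i) y) x"
      by (simp add: grad_def divergence_def[abs_def] b_def[abs_def])
    also have "\<dots> = (\<Sum>i\<in>UNIV. D k i i)"
      by (simp add: partial_sum diff D_def)
    also have "\<dots> = (\<Sum>i\<in>UNIV. D i k i)"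
      unfolding D_def by (intro sum.cong refl partial_commute[OF \<open>open \<Omega>\<close> x C2])
    finally have gd: "grad (divergence a) x $ k = (\<Sum>i\<in>UNIV. D i k i)" .
    have "M_nabla_transpose (curl a :: real^'n::{finite,linorder} \<Rightarrow> real^'m::{finite,linorder}) x $ k
        = (\<Sum>i | i < k. D i i k - D i k i) - (\<Sum>j | k < j. D j k j - D j j k)"
      unfolding M_nabla_transpose_nth[OF assms(2)]
      by (intro arg_cong2[where f = "(-)"] sum.cong refl) (simp_all add: curl partial_diff diff D_def)
    also have "\<dots> = (\<Sum>i | i < k. D i i k - D i k i) + (\<Sum>i | k < i. D i i k - D i k i)"
      by (simp add: sum_subtractf)
    also have "\<dots> = (\<Sum>i\<in>{i. i < k} \<union> {i. k < i}. D i i k - D i k i)"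
      by (rule sum.union_disjoint[symmetric]) auto
    \<comment> \<open>The term \<open>i = k\<close>, which no pair contributes, is zero.\<close>
    also have "\<dots> = (\<Sum>i\<in>UNIV. D i i k - D i k i)"
      by (rule sum.mono_neutral_left) (auto simp: not_less order_le_less)
    finally show "vector_laplacian a x $ k
        = (grad (divergence a) x + M_nabla_transpose (curl a :: real^'n::{finite,linorder} \<Rightarrow> real^'m::{finite,linorder}) x) $ k"
      by (simp add: lap gd sum_subtractf)
  qed
qed

end
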